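(* Let $\mathcal A:\mathbb C^N\to\mathbb C^{\hat N}$ be a linear mapping, let $b\in\mathbb R_+^{\hat N}$, let $\lambda>0$ and $p\ge 1$. If $\mathcal A$ is continuous, then the minimization problem $$\min_{\bm x\in\mathbb C^N}\ \mathcal G_\lambda(\bm x),\qquad \mathcal G_\lambda(\bm x):=\lambda\|\bm x\|_0+\frac1p\big\|\,b-|\mathcal A\bm x|\,\big\|_p^p,$$ admits at least one minimizer.
   Context: For $\bm x\in\mathbb C^N$, $\|\bm x\|_0:=\#\{i\in\{1,\dots,N\}: |\Re(\bm x)_i|+|\Im(\bm x)_i|\neq 0\}$ is the number of nonzero entries of $\bm x$. $|\cdot|$ applied to a vector is the componentwise absolute value (modulus), so $|\mathcal A\bm x|\in\mathbb R_+^{\hat N}$, where $\mathbb R_+$ is the set of nonnegative reals. For a vector $v$, $\|v\|_p^p:=\sum_i|v_i|^p$. *)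

theory Defs
  imports "HOL-Analysis.Analysis"
begin

definition l0_norm :: "complex ^ 'n \<Rightarrow> nat" where
  "l0_norm x = card {i. \<bar>Re (x $ i)\<bar> + \<bar>Im (x $ i)\<bar> \<noteq> 0}"

definition modulus_vec :: "complex ^ 'm \<Rightarrow> real ^ 'm" where
  "modulus_vec z = (\<chi> i. cmod (z $ i))"

text \<open>The \<open>p\<close>-th power of the \<open>p\<close>-norm. For \<open>p > 0\<close> the convention \<open>0 powr p = 0\<close>
  is the usual value.\<close>

definition pnorm_pow :: "real \<Rightarrow> real ^ 'm \<Rightarrow> real" where
  "pnorm_pow p v = (\<Sum>i\<in>UNIV. \<bar>v $ i\<bar> powr p)"

definition G_functional ::
    "(complex ^ 'n \<Rightarrow> complex ^ 'm) \<Rightarrow> real ^ 'm \<Rightarrow> real \<Rightarrow> real \<Rightarrow> complex ^ 'n \<Rightarrow> real" where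
  "G_functional A b p lam x =
     lam * real (l0_norm x) + (1 / p) * pnorm_pow p (b - modulus_vec (A x))"

end

theory Submission
  imports Defs
begin

text \<open>Vectors supported in a fixed index set \<open>S\<close> form a subspace, so their image under \<open>A\<close> is a
  subspace of a finite-dimensional space and hence closed. The data term, as a function of
  \<open>z = A x\<close>, is continuous and has bounded sublevel sets, so it attains its minimum on that image.
  (Working in the image is essential: \<open>A\<close> may have a kernel, so the functional itself need not
  have bounded sublevel sets.)
  Among the finitely many \<open>S\<close>, choose the one minimising \<open>\<lambda> |S|\<close> plus this minimum.\<close>

text \<open>\<open>subspace\<close> and \<open>closed_subspace\<close> speak of real vector spaces;
  real scaling on complex vectors is complex scaling by \<open>complex_of_real r\<close>, so complex
  linearity restricts to real linearity.\<close>

lemma linear_if_complex_linear: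
  fixes A :: "complex ^ 'n \<Rightarrow> complex ^ 'm"
  assumes "Vector_Spaces.linear (*s) (*s) A"
  shows "linear A"
proof -
  interpret Vector_Spaces.linear "(*s)" "(*s)" A by fact
  have real_scale: "r *\<^sub>R x = complex_of_real r *s x" for r :: real and x :: "complex ^ 'k"
    by (simp add: vec_eq_iff scaleR_conv_of_real[where 'a = complex])
  show ?thesis
    by (rule linearI) (simp_all add: add real_scale scale)
qed

lemma continuous_on_data_term:
  assumes "p > 0"
  shows "continuous_on T (\<lambda>z. pnorm_pow p (b - modulus_vec z))"
  unfolding pnorm_pow_def modulus_vec_def
  \<comment> \<open>The base of \<open>powr\<close> vanishes where a modulus equals
    \<open>b $ i\<close>; continuity there rests on \<open>p > 0\<close>.\<close>
  using assms by (auto intro!: continuous_intros continuous_on_powr')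

text \<open>Every summand is nonnegative, hence at most \<open>c\<close>. This bounds each deviation
  from \<open>b $ i\<close>, thus each modulus, and the norm is at most the sum of the
  moduli.\<close>

lemma bounded_data_term_sublevel:
  fixes b :: "real ^ 'm"
  assumes "p \<ge> 1"
  shows "bounded {z. pnorm_pow p (b - modulus_vec z) \<le> c}"
proof (rule boundedI)
  fix z assume "z \<in> {z. pnorm_pow p (b - modulus_vec z) \<le> c}"
  hence z: "(\<Sum>i\<in>UNIV. \<bar>b $ i - cmod (z $ i)\<bar> powr p) \<le> c"
    by (simp add: pnorm_pow_def modulus_vec_def)
  have component: "cmod (z $ i) \<le> \<bar>b $ i\<bar> + 1 + c" for i
  proof -
    let ?t = "\<bar>b $ i - cmod (z $ i)\<bar>"
    \<comment> \<open>A crude bound that avoids p-th roots: for \<open>?t > 1\<close>, the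
      assumption \<open>p \<ge> 1\<close> gives \<open>?t \<le> ?t powr p\<close>.\<close>
    have "?t \<le> 1 + ?t powr p"
    proof (cases "?t \<le> 1")
      case True
      thus ?thesis using powr_ge_zero[of ?t p] by linarith
    next
      case False
      thus ?thesis using powr_mono[of 1 p ?t] assms by simp
    qed
    moreover have "?t powr p \<le> (\<Sum>i\<in>UNIV. \<bar>b $ i - cmod (z $ i)\<bar> powr p)"
      by (rule member_le_sum) auto
    ultimately show ?thesis using z by linarith
  qed
  have "norm z \<le> (\<Sum>i\<in>UNIV. cmod (z $ i))"
    unfolding norm_vec_def by (rule L2_set_le_sum) simp
  also have "\<dots> \<le> (\<Sum>i\<in>UNIV. \<bar>b $ i\<bar> + 1 + c)"
    by (rule sum_mono) (rule component)
  finally show "norm z \<le> (\<Sum>i\<in>UNIV. \<bar>b $ i\<bar> + 1 + c)" .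
qed

text \<open>The sublevel set at \<open>a\<close> is compact and contains \<open>a\<close>, so a
  minimiser on it has value at most \<open>f a\<close>, while points of \<open>T\<close> outside it
  have values above \<open>f a\<close>.\<close>

lemma attains_inf_if_bounded_sublevel:
  fixes f :: "'a::heine_borel \<Rightarrow> real"
  assumes "closed T" "a \<in> T" "continuous_on T f" "bounded {z \<in> T. f z \<le> f a}"
  shows "\<exists>x\<in>T. \<forall>y\<in>T. f x \<le> f y"
proof -
  let ?K = "{z \<in> T. f z \<le> f a}"
  have "closed ?K"
    using assms by (intro continuous_on_closed_Collect_le continuous_on_const)
  hence "compact ?K" using assms(4) compact_eq_bounded_closed by blast
  moreover have "continuous_on ?K f"
    using assms(3) by (rule continuous_on_subset) auto
  ultimately obtain x where "x \<in> ?K" "\<forall>y\<in>?K. f x \<le> f y"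
    using continuous_attains_inf[of ?K f] assms(2) by blast
  thus ?thesis by (metis (mono_tags, lifting) mem_Collect_eq linorder_le_cases order_trans)
qed

lemma data_term_attains_min_on_support:
  fixes A :: "complex ^ 'n \<Rightarrow> complex ^ 'm"
  assumes "linear A" "p \<ge> 1"
  shows "\<exists>x. (\<forall>i. i \<notin> S \<longrightarrow> x $ i = 0) \<and> (\<forall>y. (\<forall>i. i \<notin> S \<longrightarrow> y $ i = 0) \<longrightarrow>
    pnorm_pow p (b - modulus_vec (A x)) \<le> pnorm_pow p (b - modulus_vec (A y)))"
proof -
  let ?V = "{x :: complex ^ 'n. \<forall>i. i \<notin> S \<longrightarrow> x $ i = 0}"
  let ?f = "\<lambda>z. pnorm_pow p (b - modulus_vec z)"
  have "subspace ?V" by (auto simp: subspace_def)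
  hence V: "subspace (A ` ?V)" by (rule linear_subspace_image[OF assms(1)])
  have "\<exists>z\<in>A ` ?V. \<forall>w\<in>A ` ?V. ?f z \<le> ?f w"
  proof (rule attains_inf_if_bounded_sublevel)
    show "closed (A ` ?V)" using V by (rule closed_subspace)
    show "0 \<in> A ` ?V" using V by (rule subspace_0)
    show "continuous_on (A ` ?V) ?f" using assms(2) by (intro continuous_on_data_term) simp
    show "bounded {z \<in> A ` ?V. ?f z \<le> ?f 0}"
      by (rule bounded_subset[OF bounded_data_term_sublevel[OF assms(2)]]) auto
  qed
  thus ?thesis by blast
qed

theorem theorem1:
  fixes A :: "complex ^ 'n \<Rightarrow> complex ^ 'm"
    and b :: "real ^ 'm"
    and p lam :: real
  assumes "Vector_Spaces.linear (*s) (*s) A"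
    and "\<forall>i. 0 \<le> b $ i"
    and "lam > 0"
    and "p \<ge> 1"
    and "continuous_on UNIV A"
  shows "\<exists>x. \<forall>y. G_functional A b p lam x \<le> G_functional A b p lam y"
proof -
  let ?f = "\<lambda>x. pnorm_pow p (b - modulus_vec (A x))"
  have "\<forall>S. \<exists>x. (\<forall>i. i \<notin> S \<longrightarrow> x $ i = 0) \<and> (\<forall>y. (\<forall>i. i \<notin> S \<longrightarrow> y $ i = 0) \<longrightarrow> ?f x \<le> ?f y)"
    using data_term_attains_min_on_support[OF linear_if_complex_linear[OF assms(1)] assms(4)] ..
  from this[unfolded choice_iff] obtain X where
    X: "\<forall>S. (\<forall>i. i \<notin> S \<longrightarrow> X S $ i = 0) \<and> (\<forall>y. (\<forall>i. i \<notin> S \<longrightarrow> y $ i = 0) \<longrightarrow> ?f (X S) \<le> ?f y)"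
    by (elim exE)
  have X0: "X S $ i = 0" if "i \<notin> S" for S i
    using X that by simp
  have Xmin: "?f (X S) \<le> ?f y" if "\<And>i. i \<notin> S \<Longrightarrow> y $ i = 0" for S y
    using X that by simp
  \<comment> \<open>Charging for all of \<open>S\<close> rather than the support of
    \<open>X S\<close> leaves a finite minimisation over index sets.\<close>
  define g where "g S = lam * real (card S) + (1 / p) * ?f (X S)" for S
  obtain S where S: "\<And>S'. g S \<le> g S'"
    using ex_min_if_finite[of "range g"] by (auto simp: not_less)
  have l0: "l0_norm x = card {i. x $ i \<noteq> 0}" for x :: "complex ^ 'n"
  proof -
    have "\<bar>Re c\<bar> + \<bar>Im c\<bar> \<noteq> 0 \<longleftrightarrow> c \<noteq> 0" for c
      by (auto simp: complex_eq_iff)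
    thus ?thesis by (simp add: l0_norm_def)
  qed
  have "G_functional A b p lam (X S) \<le> G_functional A b p lam y" for y
  proof -
    \<comment> \<open>\<open>X S\<close> may vanish at some indices in \<open>S\<close>, so
      \<open>g S\<close> only bounds the functional from above.\<close>
    have "card {i. X S $ i \<noteq> 0} \<le> card S"
      using X0 by (intro card_mono) auto
    hence "G_functional A b p lam (X S) \<le> g S"
      using assms(3) by (simp add: G_functional_def g_def l0)
    also have "\<dots> \<le> g {i. y $ i \<noteq> 0}" by (rule S)
    \<comment> \<open>With the support of \<open>y\<close> as index set, the sparsity terms agree
      and \<open>y\<close> itself competes with the chosen minimiser.\<close>
    also have "\<dots> \<le> G_functional A b p lam y"
      using Xmin[of "{i. y $ i \<noteq> 0}" y] assms(4)
      by (simp add: G_functional_def g_def l0 divide_right_mono)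
    finally show ?thesis .
  qed
  thus ?thesis by blast
qed

end
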